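(* Let $r>6$ and $n$ be integers with $3r+3\le n\le r^2$, and put $a=n-2r+1$ and $b=2r-1$. Let $X$ be any graph on $a$ vertices such that (i) $\alpha(X)\le r-1$, (ii) $\kappa(X)\ge a-b$, and (iii) $\Delta(X)\ge r+2$. Let $H$ be any graph on $b$ vertices with $\alpha(H)\le r-1$. Then the join $G=X\vee H$ satisfies: (1) $G$ is $(n-2r+1)$-connected; (2) $G$ contains no induced subgraph isomorphic to $K_{r,r+1}$ or $K_{r+1,r+1}$; (3) $\Delta(G)\ge 3r+1$, and thus $\frac{\Delta(G)+2}{r+1}\ge 3$. Consequently, $\chi_{D_L}(G)\le 2\Delta(G)-5$.
   Context: All graphs are finite and simple. $\Delta(G)$ is the maximum degree of $G$, $\alpha(G)$ is the maximum size of an independent set of $G$, and $K_{s,t}$ is the complete bipartite graph with parts of sizes $s$ and $t$. The join $G_1\vee G_2$ is obtained from the disjoint union of $G_1$ and $G_2$ by adding all edges between $V(G_1)$ and $V(G_2)$. A graph is $k$-connected if it has at least $k+1$ vertices and removal of any $k-1$ or fewer vertices leaves a connected graph; $\kappa(G)$ is the largest $k$ for which $G$ is $k$-connected (so $\kappa(K_m)=m-1$). Given an assignment $L=\{L(v)\}_{v\in V(G)}$ of lists of available colors to the vertices of $G$, the graph $G$ is properly $L$-distinguishable if there is a proper vertex coloring $f$ of $G$ such that $f(v)\in L(v)$ for all $v\in V(G)$ and the only automorphism $\phi$ of $G$ preserving $f$ (i.e. $f(\phi(v))=f(v)$ for all $v$) is the identity. The list-distinguishing chromatic number $\chi_{D_L}(G)$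 is the minimum integer $k$ such that $G$ is properly $L$-distinguishable for every list assignment $L$ with $|L(v)|=k$ for all $v\in V(G)$. *)

theory Defs
  imports Complex_Main "Graph_Theory.Graph_Theory"
begin

text \<open>
  Finite simple graphs are the \<open>pair_graph\<close>s of the AFP entry Graph_Theory: finite, loop-free,
  symmetric digraphs whose arcs are pairs of vertices.
\<close>

definition graph_join ::
  "'a pair_pre_digraph \<Rightarrow> 'b pair_pre_digraph \<Rightarrow> ('a + 'b) pair_pre_digraph" where
  "graph_join G1 G2 = \<lparr>
     pverts = pverts G1 <+> pverts G2,
     parcs = {(Inl u, Inl v) | u v. (u, v) \<in> parcs G1} \<union> {(Inr u, Inr v) | u v. (u, v) \<in> parcs G2}
       \<union> {(Inl u, Inr v) | u v. u \<in> pverts G1 \<and> v \<in> pverts G2}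
       \<union> {(Inr v, Inl u) | u v. u \<in> pverts G1 \<and> v \<in> pverts G2} \<rparr>"

lemma pair_graph_graph_join:
  assumes "pair_graph G1" and "pair_graph G2"
  shows "pair_graph (graph_join G1 G2)"
proof -
  interpret A: pair_graph G1 by fact
  interpret B: pair_graph G2 by fact
  let ?G = "graph_join G1 G2"
  have vs: "pverts ?G = pverts G1 <+> pverts G2" by (simp add: graph_join_def)
  have fin: "finite (pverts ?G)" by (simp add: vs)
  have sub: "parcs ?G \<subseteq> pverts ?G \<times> pverts ?G"
    using A.in_arcsD1 A.in_arcsD2 B.in_arcsD1 B.in_arcsD2 by (auto simp: graph_join_def)
  have "sym (parcs ?G)"
    using arcs_ends_symmetric[OF A.sym_arcs] arcs_ends_symmetric[OF B.sym_arcs]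
    by (auto simp: graph_join_def intro!: symI)
  then have "symmetric (with_proj ?G)" by (simp add: symmetric_def)
  moreover have "finite (parcs ?G)" using fin sub by (meson finite_SigmaI finite_subset)
  moreover have "\<And>e. e \<in> parcs ?G \<Longrightarrow> fst e \<noteq> snd e"
    using A.pair_no_loops B.pair_no_loops by (fastforce simp: graph_join_def)
  ultimately show ?thesis using sub fin by unfold_locales auto
qed

definition independent_set :: "('a, 'e) pre_digraph \<Rightarrow> 'a set \<Rightarrow> bool" where
  "independent_set G S \<longleftrightarrow> S \<subseteq> verts G \<and> (\<forall>u\<in>S. \<forall>v\<in>S. (u, v) \<notin> arcs_ends G)"

definition independence_number :: "('a, 'e) pre_digraph \<Rightarrow> nat" where
  "independence_number G = Max (card ` {S. independent_set G S})"

text \<open>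
  In a symmetric digraph the out-degree is the degree of the underlying undirected graph.
  The maximum is meaningful only for graphs with at least one vertex.
\<close>

definition max_degree :: "('a, 'e) pre_digraph \<Rightarrow> nat" where
  "max_degree G = Max (out_degree G ` verts G)"

text \<open>Every nonempty graph is 0-connected: the second condition is vacuous for \<open>k = 0\<close>.\<close>

definition k_connected :: "nat \<Rightarrow> ('a, 'e) pre_digraph \<Rightarrow> bool" where
  "k_connected k G \<longleftrightarrow> k + 1 \<le> card (verts G) \<and>
     (\<forall>S \<subseteq> verts G. card S < k \<longrightarrow> Digraph_Component.connected (G \<restriction> (verts G - S)))"

definition connectivity :: "('a, 'e) pre_digraph \<Rightarrow> nat" where
  "connectivity G = (GREATEST k. k_connected k G)"

definition proper_coloring :: "('a, 'e) pre_digraph \<Rightarrow> ('a \<Rightarrow> 'c) \<Rightarrow> bool" where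
  "proper_coloring G f \<longleftrightarrow> (\<forall>(u, v) \<in> arcs_ends G. f u \<noteq> f v)"

text \<open>
  An automorphism is an isomorphism of Graph_Theory that maps the graph onto itself; only its action
  on the vertices of the graph matters.
\<close>

definition distinguishing_coloring :: "('a, 'e) pre_digraph \<Rightarrow> ('a \<Rightarrow> 'c) \<Rightarrow> bool" where
  "distinguishing_coloring G f \<longleftrightarrow>
     (\<forall>\<phi>. pre_digraph.digraph_isomorphism G \<phi> \<and> app_iso \<phi> G = G \<and>
          (\<forall>v \<in> verts G. f (iso_verts \<phi> v) = f v) \<longrightarrow>
        (\<forall>v \<in> verts G. iso_verts \<phi> v = v))"

definition properly_L_distinguishable ::
  "('a \<Rightarrow> 'c set) \<Rightarrow> ('a, 'e) pre_digraph \<Rightarrow> bool" where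
  "properly_L_distinguishable L G \<longleftrightarrow>
     (\<exists>f. proper_coloring G f \<and> (\<forall>v \<in> verts G. f v \<in> L v) \<and> distinguishing_coloring G f)"

text \<open>
  A list assignment with finite lists on a finite graph uses only finitely many colors, so taking
  colors to be natural numbers is no restriction. The finiteness condition is needed because
  \<open>card\<close> is 0 on infinite sets.
\<close>

definition list_dist_chromatic_number :: "('a, 'e) pre_digraph \<Rightarrow> nat" where
  "list_dist_chromatic_number G =
     (LEAST k. \<forall>L :: 'a \<Rightarrow> nat set. (\<forall>v \<in> verts G. finite (L v) \<and> card (L v) = k) \<longrightarrow>
        properly_L_distinguishable L G)"

end

theory Submission
  imports Defs
begin

text \<open>
  The first three claims are read off the join. An independent set cannot meet both sides, so
  \<open>\<alpha>(X \<or> H) \<le> r - 1\<close>, whereas an induced \<open>K_{r,r+1}\<close> or \<open>K_{r+1,r+1}\<close> would contain an independent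
  set of size \<open>r + 1\<close>. A vertex of maximum degree in \<open>X\<close> gains the \<open>2 r - 1\<close> vertices of \<open>H\<close>
  as neighbours, whence \<open>\<Delta>(G) \<ge> (r + 2) + (2 r - 1)\<close>. What remains of the join after a deletion is connected as soon
  as both sides survive; deleting fewer than \<open>a\<close> vertices cannot exhaust \<open>X\<close>, and if it exhausts
  \<open>H\<close> then fewer than \<open>a - b\<close> vertices of \<open>X\<close> are gone, so the connectivity of \<open>X\<close> applies.

  The bound on the list-distinguishing chromatic number follows from
  \<open>\<chi>\<^sub>D\<^sub>L(G) \<le> |V(G)| = n \<le> 2 \<Delta>(G) - 5\<close>. The first inequality holds because lists of size
  \<open>n\<close> allow pairwise distinct colors, and a coloring with distinct colors is proper and is
  preserved by the identity only. For the second, \<open>\<Delta>(G) \<ge> 3 r + 1\<close> gives \<open>2 \<Delta>(G) - 5 \<ge> 6 r - 3\<close>,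
  which covers \<open>n \<le> 6 r - 3\<close>; and every vertex of \<open>H\<close> is adjacent to all \<open>n - 2 r + 1\<close> vertices of
  \<open>X\<close>, so \<open>2 \<Delta>(G) - 5 \<ge> 2 n - 4 r - 3\<close>, which covers \<open>n \<ge> 4 r + 3\<close>. As \<open>r > 6\<close>, the two
  ranges cover every \<open>n\<close>.
\<close>

section \<open>Connectivity of joins\<close>

lemma graph_join_simps [simp]:
  "pverts (graph_join G1 G2) = pverts G1 <+> pverts G2"
  "(Inl u, Inl u') \<in> parcs (graph_join G1 G2) \<longleftrightarrow> (u, u') \<in> parcs G1"
  "(Inr v, Inr v') \<in> parcs (graph_join G1 G2) \<longleftrightarrow> (v, v') \<in> parcs G2"
  "(Inl u, Inr v) \<in> parcs (graph_join G1 G2) \<longleftrightarrow> u \<in> pverts G1 \<and> v \<in> pverts G2"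
  "(Inr v, Inl u) \<in> parcs (graph_join G1 G2) \<longleftrightarrow> u \<in> pverts G1 \<and> v \<in> pverts G2"
  by (auto simp: graph_join_def)

lemma arcs_ends_induce_subgraph:
  "arcs_ends (G \<restriction> A) = {(u, v) \<in> arcs_ends G. u \<in> A \<and> v \<in> A}"
  by (auto simp: arcs_ends_conv)

text \<open>
  A homomorphism that is onto the vertices carries walks to walks. This moves connectedness from a
  side of a join to its copy inside the join.
\<close>

lemma connected_hom_image:
  assumes conn: "Digraph_Component.connected G"
    and verts: "verts G' = f ` verts G"
    and hom: "\<And>u v. (u, v) \<in> arcs_ends G \<Longrightarrow> (f u, f v) \<in> arcs_ends G'"
  shows "Digraph_Component.connected G'"
proof -
  have arc: "(f u, f v) \<in> (arcs_ends G')\<^sup>s" if "(u, v) \<in> (arcs_ends G)\<^sup>s" for u v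
    using that hom by (force simp: symcl_def)
  have "(f u, f v) \<in> rtrancl_on (verts G') ((arcs_ends G')\<^sup>s)"
    if "(u, v) \<in> rtrancl_on (verts G) ((arcs_ends G)\<^sup>s)" for u v
    using that
  proof (induct rule: rtrancl_on_induct)
    case base
    then show ?case by (simp add: verts)
  next
    case (step y z)
    then show ?case
      using arc by (auto simp: verts intro: rtrancl_on_into_rtrancl_on)
  qed
  then show ?thesis
    using conn by (auto simp: connected_conv verts)
qed

text \<open>
  Two vertices on opposite sides are adjacent, and two on the same side have a common neighbour on
  the other one.
\<close>

lemma connected_induced_graph_join:
  assumes "A \<subseteq> pverts G1" "A \<noteq> {}" and "B \<subseteq> pverts G2" "B \<noteq> {}"
  shows "Digraph_Component.connected (with_proj (graph_join G1 G2) \<restriction> (A <+> B))"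
proof -
  let ?J = "with_proj (graph_join G1 G2) \<restriction> (A <+> B)"
  let ?R = "rtrancl_on (A <+> B) ((arcs_ends ?J)\<^sup>s)"
  have lr: "(Inl x, Inr y) \<in> ?R" and rl: "(Inr y, Inl x) \<in> ?R" if "x \<in> A" "y \<in> B" for x y
  proof -
    have "(Inl x, Inr y) \<in> (arcs_ends ?J)\<^sup>s" "(Inr y, Inl x) \<in> (arcs_ends ?J)\<^sup>s"
      using that assms by (auto simp: symcl_def arcs_ends_induce_subgraph)
    then show "(Inl x, Inr y) \<in> ?R" "(Inr y, Inl x) \<in> ?R"
      using that by (auto intro: rtrancl_on_into_rtrancl_on)
  qed
  obtain p q where pq: "p \<in> A" "q \<in> B" using assms by auto
  have "(u, v) \<in> ?R" if u: "u \<in> A <+> B" and v: "v \<in> A <+> B" for u v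
  proof (cases u; cases v)
    fix x x' assume "u = Inl x" "v = Inl x'"
    then show ?thesis using u v pq rtrancl_on_trans[OF lr rl] by blast
  next
    fix y y' assume "u = Inr y" "v = Inr y'"
    then show ?thesis using u v pq rtrancl_on_trans[OF rl lr] by blast
  qed (use u v lr rl in auto)
  then show ?thesis using pq by (auto simp: connected_conv)
qed

text \<open>
  A deletion that leaves vertices on both sides is harmless, so only deletions that contain a whole
  side matter. Exhausting one side costs its number of vertices, and what is left of the budget
  \<open>k\<close> is spent on the other side. The differences are truncated: a side of at least \<open>k\<close> vertices
  cannot be exhausted, and then the other side only has to be nonempty.
\<close>

lemma k_connected_graph_join:
  assumes fin: "finite (pverts G1)" "finite (pverts G2)"
    and conn1: "k_connected (k - card (pverts G2)) (with_proj G1)"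
    and conn2: "k_connected (k - card (pverts G1)) (with_proj G2)"
  shows "k_connected k (with_proj (graph_join G1 G2))"
  unfolding k_connected_def
proof (intro conjI allI impI)
  show "k + 1 \<le> card (verts (with_proj (graph_join G1 G2)))"
  proof -
    have "k - card (pverts G2) + 1 \<le> card (pverts G1)"
      using conn1 by (simp add: k_connected_def)
    then show ?thesis using fin by (simp add: card_Plus)
  qed
next
  let ?J = "with_proj (graph_join G1 G2)"
  fix S assume S: "S \<subseteq> verts ?J" and card_S: "card S < k"
  define A where "A = Inl -` S"
  define B where "B = Inr -` S"
  have S_eq: "S = A <+> B"
  proof (rule set_eqI)
    fix x show "x \<in> S \<longleftrightarrow> x \<in> A <+> B" by (cases x) (auto simp: A_def B_def)
  qed
  have sub: "A \<subseteq> pverts G1" "B \<subseteq> pverts G2" using S by (auto simp: A_def B_def)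
  then have "finite A" "finite B" using fin finite_subset by auto
  then have card_AB: "card A + card B < k" using card_S by (simp add: S_eq card_Plus)
  have rest: "verts ?J - S = (pverts G1 - A) <+> (pverts G2 - B)" by (auto simp: S_eq)
  consider "B = pverts G2" | "A = pverts G1" | "A \<noteq> pverts G1" "B \<noteq> pverts G2" by blast
  then show "Digraph_Component.connected (?J \<restriction> (verts ?J - S))"
  proof cases
    case 1
    then have "Digraph_Component.connected (with_proj G1 \<restriction> (pverts G1 - A))"
      using conn1 card_AB sub by (simp add: k_connected_def)
    then show ?thesis
      unfolding rest
      by (rule connected_hom_image[where f = Inl])
        (use 1 in \<open>auto simp: arcs_ends_induce_subgraph\<close>)
  next
    case 2
    then have "Digraph_Component.connected (with_proj G2 \<restriction> (pverts G2 - B))"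
      using conn2 card_AB sub by (simp add: k_connected_def)
    then show ?thesis
      unfolding rest
      by (rule connected_hom_image[where f = Inr])
        (use 2 in \<open>auto simp: arcs_ends_induce_subgraph\<close>)
  next
    case 3
    then show ?thesis
      unfolding rest using sub by (intro connected_induced_graph_join) auto
  qed
qed

lemma k_connected_mono:
  assumes "k_connected k G" and "j \<le> k"
  shows "k_connected j G"
  using assms by (auto simp: k_connected_def)

text \<open>
  The greatest \<open>k\<close> in the definition of the connectivity exists: \<open>k = 0\<close> is possible, and
  \<open>k\<close> is below the number of vertices.
\<close>

lemma k_connected_connectivity:
  assumes "finite (verts G)" and "verts G \<noteq> {}"
  shows "k_connected (connectivity G) G"
  unfolding connectivity_def
proof (rule GreatestI_nat)
  show "k_connected 0 G"
    using assms by (simp add: k_connected_def Suc_le_eq card_gt_0_iff)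
  show "\<And>k. k_connected k G \<Longrightarrow> k \<le> card (verts G)"
    by (simp add: k_connected_def)
qed

section \<open>Independent sets and degrees in joins\<close>

lemma card_le_independence_number:
  assumes "finite (verts G)" and "independent_set G S"
  shows "card S \<le> independence_number G"
proof -
  have "finite {T. independent_set G T}"
    by (rule finite_subset[of _ "Pow (verts G)"]) (use assms in \<open>auto simp: independent_set_def\<close>)
  then show ?thesis
    unfolding independence_number_def using assms by (intro Max_ge) auto
qed

lemma card_independent_set_graph_join:
  assumes fin: "finite (pverts G1)" "finite (pverts G2)"
    and ind: "independent_set (with_proj (graph_join G1 G2)) S"
  shows "card S \<le> max (independence_number (with_proj G1)) (independence_number (with_proj G2))"
proof -
  have no_arc: "(x, y) \<notin> parcs (graph_join G1 G2)" if "x \<in> S" "y \<in> S" for x y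
    using ind that by (auto simp: independent_set_def)
  have sub: "S \<subseteq> pverts G1 <+> pverts G2"
    using ind by (auto simp: independent_set_def)
  have "S \<subseteq> range Inl \<or> S \<subseteq> range Inr"
  proof (rule ccontr)
    assume "\<not> ?thesis"
    then obtain x y where xy: "x \<in> S" "x \<notin> range Inl" "y \<in> S" "y \<notin> range Inr" by blast
    then obtain u v where "x = Inr v" "y = Inl u" by (cases x; cases y) auto
    then show False using no_arc[of y x] xy sub by auto
  qed
  then show ?thesis
  proof
    assume "S \<subseteq> range Inl"
    then obtain T where T: "S = Inl ` T" by (auto simp: subset_image_iff)
    have "(u, v) \<notin> parcs G1" if "u \<in> T" "v \<in> T" for u v
      using no_arc[of "Inl u" "Inl v"] that T by simp
    then have "independent_set (with_proj G1) T"
      using sub T by (auto simp: independent_set_def)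
    then have "card T \<le> independence_number (with_proj G1)"
      using fin by (intro card_le_independence_number) auto
    then show ?thesis by (simp add: T card_image)
  next
    assume "S \<subseteq> range Inr"
    then obtain T where T: "S = Inr ` T" by (auto simp: subset_image_iff)
    have "(u, v) \<notin> parcs G2" if "u \<in> T" "v \<in> T" for u v
      using no_arc[of "Inr u" "Inr v"] that T by simp
    then have "independent_set (with_proj G2) T"
      using sub T by (auto simp: independent_set_def)
    then have "card T \<le> independence_number (with_proj G2)"
      using fin by (intro card_le_independence_number) auto
    then show ?thesis by (simp add: T card_image)
  qed
qed

lemma arcs_ends_induced_subgraph:
  assumes "induced_subgraph H G"
  shows "arcs_ends H = {(u, v) \<in> arcs_ends G. u \<in> verts H \<and> v \<in> verts H}"
proof -
  have "tail H = tail G" "head H = head G"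
    using assms by (auto simp: induced_subgraph_def subgraph_def compatible_def)
  then show ?thesis
    using assms by (auto simp: induced_subgraph_def arcs_ends_conv)
qed

lemma induced_complete_bipartite_independent_set:
  assumes ind: "induced_subgraph S G" and K: "complete_bipartite_digraph m n S"
  obtains V where "independent_set G V" and "card V = n"
proof -
  obtain U V where UV: "verts S = U \<union> V" "U \<inter> V = {}" "card V = n"
      "arcs_ends S = U \<times> V \<union> V \<times> U"
    using K by (auto simp: complete_bipartite_digraph_def)
  have "verts S \<subseteq> verts G"
    using ind by (auto simp: induced_subgraph_def subgraph_def)
  moreover have "(u, v) \<notin> arcs_ends G" if "u \<in> V" "v \<in> V" for u v
  proof -
    have "(u, v) \<notin> arcs_ends S" using UV that by blast
    then show ?thesis using arcs_ends_induced_subgraph[OF ind] UV that by simp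
  qed
  ultimately have "independent_set G V"
    using UV by (auto simp: independent_set_def)
  then show thesis using UV that by blast
qed

lemma out_degree_graph_join_Inl:
  fixes G1 :: "'a pair_pre_digraph" and G2 :: "'b pair_pre_digraph"
  assumes "finite (parcs G1)" "finite (pverts G2)" and u: "u \<in> pverts G1"
  shows "out_degree (with_proj (graph_join G1 G2)) (Inl u)
    = out_degree (with_proj G1) u + card (pverts G2)"
proof -
  let ?in = "(\<lambda>(x, y). (Inl x :: 'a + 'b, Inl y :: 'a + 'b)) ` out_arcs (with_proj G1) u"
  let ?across = "(\<lambda>v. (Inl u :: 'a + 'b, Inr v :: 'a + 'b)) ` pverts G2"
  have "out_arcs (with_proj (graph_join G1 G2)) (Inl u) = ?in \<union> ?across"
    using u by (auto simp: out_arcs_def graph_join_def image_iff)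
  moreover have "?in \<inter> ?across = {}" by auto
  moreover have "finite (out_arcs (with_proj G1) u)"
    using assms by (simp add: out_arcs_def)
  moreover have "card ?in = card (out_arcs (with_proj G1) u)" "card ?across = card (pverts G2)"
    by (auto intro!: card_image inj_onI)
  ultimately show ?thesis
    using assms card_Un_disjoint[of ?in ?across] by (simp add: out_degree_def)
qed

lemma out_degree_graph_join_Inr_ge:
  fixes G1 :: "'a pair_pre_digraph" and G2 :: "'b pair_pre_digraph"
  assumes "finite (parcs (graph_join G1 G2))" and v: "v \<in> pverts G2"
  shows "card (pverts G1) \<le> out_degree (with_proj (graph_join G1 G2)) (Inr v)"
proof -
  let ?across = "(\<lambda>u. (Inr v :: 'a + 'b, Inl u :: 'a + 'b)) ` pverts G1"
  have "finite (out_arcs (with_proj (graph_join G1 G2)) (Inr v))"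
    using assms by (simp add: out_arcs_def)
  moreover have "?across \<subseteq> out_arcs (with_proj (graph_join G1 G2)) (Inr v)"
    using v by (auto simp: out_arcs_def)
  ultimately have "card ?across \<le> out_degree (with_proj (graph_join G1 G2)) (Inr v)"
    unfolding out_degree_def by (rule card_mono)
  moreover have "card ?across = card (pverts G1)"
    by (auto intro!: card_image inj_onI)
  ultimately show ?thesis by simp
qed

lemma out_degree_le_max_degree:
  assumes "finite (verts G)" and "v \<in> verts G"
  shows "out_degree G v \<le> max_degree G"
  using assms by (auto simp: max_degree_def)

lemma max_degree_graph_join_ge:
  assumes "pair_graph G1" "pair_graph G2" and "pverts G1 \<noteq> {}"
  shows "max_degree (with_proj G1) + card (pverts G2) \<le> max_degree (with_proj (graph_join G1 G2))"
proof -
  interpret G1: pair_graph G1 by fact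
  interpret G2: pair_graph G2 by fact
  have "max_degree (with_proj G1) \<in> out_degree (with_proj G1) ` pverts G1"
    using assms by (simp add: max_degree_def)
  then obtain u where "u \<in> pverts G1" "max_degree (with_proj G1) = out_degree (with_proj G1) u"
    by auto
  then show ?thesis
    using out_degree_le_max_degree[of "with_proj (graph_join G1 G2)" "Inl u"]
    by (simp add: out_degree_graph_join_Inl InlI)
qed

lemma card_left_le_max_degree_graph_join:
  assumes "pair_graph G1" "pair_graph G2" and "pverts G2 \<noteq> {}"
  shows "card (pverts G1) \<le> max_degree (with_proj (graph_join G1 G2))"
proof -
  interpret J: pair_graph "graph_join G1 G2" using assms(1,2) by (rule pair_graph_graph_join)
  obtain v where v: "v \<in> pverts G2" using assms by auto
  have "out_degree (with_proj (graph_join G1 G2)) (Inr v)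
      \<le> max_degree (with_proj (graph_join G1 G2))"
    by (rule out_degree_le_max_degree) (use v J.pair_finite_verts in auto)
  then show ?thesis
    using out_degree_graph_join_Inr_ge[OF J.pair_finite_arcs v] by linarith
qed

section \<open>The trivial bound on the list-distinguishing chromatic number\<close>

text \<open>Choosing greedily, each new element finds a color that the others have not taken.\<close>

lemma inj_list_choice:
  assumes "finite A" and "\<And>v. v \<in> A \<Longrightarrow> card A \<le> card (L v)"
  obtains f where "inj_on f A" and "\<And>v. v \<in> A \<Longrightarrow> f v \<in> L v"
proof -
  have "\<exists>f. inj_on f A \<and> (\<forall>v\<in>A. f v \<in> L v)"
    using assms
  proof (induction A rule: finite_induct)
    case empty
    then show ?case by simp
  next
    case (insert x A)
    have "card A \<le> card (L v)" if "v \<in> A" for v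
      using insert.prems[of v] insert.hyps that by simp
    then obtain f where f: "inj_on f A" "\<forall>v\<in>A. f v \<in> L v" using insert.IH by blast
    have "\<not> L x \<subseteq> f ` A"
    proof
      assume "L x \<subseteq> f ` A"
      then have "card (L x) \<le> card A"
        using insert.hyps by (meson card_image_le card_mono finite_imageI order_trans)
      then show False using insert.prems[of x] insert.hyps by simp
    qed
    then obtain c where c: "c \<in> L x" "c \<notin> f ` A" by blast
    let ?g = "f(x := c)"
    have "inj_on ?g (insert x A)"
      using f(1) c(2) insert.hyps by (auto simp: inj_on_def)
    moreover have "\<forall>v\<in>insert x A. ?g v \<in> L v" using f c by auto
    ultimately show ?case by blast
  qed
  then show thesis using that by blast
qed

lemma list_dist_chromatic_number_le_card:
  fixes G :: "('a, 'e) pre_digraph"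
  assumes "digraph G"
  shows "list_dist_chromatic_number G \<le> card (verts G)"
  unfolding list_dist_chromatic_number_def
proof (rule Least_le, intro allI impI)
  interpret digraph G by fact
  fix L :: "'a \<Rightarrow> nat set"
  assume L: "\<forall>v\<in>verts G. finite (L v) \<and> card (L v) = card (verts G)"
  obtain f where inj: "inj_on f (verts G)" and lists: "\<And>v. v \<in> verts G \<Longrightarrow> f v \<in> L v"
    by (rule inj_list_choice[of "verts G" L]) (use L in auto)
  have "proper_coloring G f"
    unfolding proper_coloring_def
  proof (intro ballI, clarify)
    fix u v assume arc: "(u, v) \<in> arcs_ends G" and "f u = f v"
    then have "u = v" using adj_in_verts[OF arc] inj by (auto dest: inj_onD)
    then show False using arc adj_not_same by blast
  qed
  moreover have "distinguishing_coloring G f"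
    unfolding distinguishing_coloring_def
  proof (intro allI impI ballI, elim conjE)
    fix \<phi> :: "('a, 'e, 'a, 'e) digraph_isomorphism" and v
    assume iso: "app_iso \<phi> G = G" and pres: "\<forall>v\<in>verts G. f (iso_verts \<phi> v) = f v"
      and v: "v \<in> verts G"
    have "iso_verts \<phi> ` verts G = verts G"
      using verts_app_iso[of \<phi> G] by (simp add: iso)
    then have "iso_verts \<phi> v \<in> verts G" using v by blast
    then show "iso_verts \<phi> v = v" using inj pres v by (auto dest: inj_onD)
  qed
  ultimately show "properly_L_distinguishable L G"
    unfolding properly_L_distinguishable_def using lists by blast
qed

section \<open>Joins of two graphs with small independence number\<close>

theorem theorem4p1:
  fixes r n a b :: nat
    and X :: "'a pair_pre_digraph" and H :: "'b pair_pre_digraph"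
    and G :: "('a + 'b) pair_pre_digraph"
  assumes "r > 6" and "3 * r + 3 \<le> n" and "n \<le> r ^ 2"
    and "a = n - 2 * r + 1" and "b = 2 * r - 1"
    and "pair_graph X" and "card (pverts X) = a"
    and "independence_number (with_proj X) \<le> r - 1"
    and "int (connectivity (with_proj X)) \<ge> int a - int b"
    and "max_degree (with_proj X) \<ge> r + 2"
    and "pair_graph H" and "card (pverts H) = b"
    and "independence_number (with_proj H) \<le> r - 1"
    and "G = graph_join X H"
  shows "k_connected (n - 2 * r + 1) (with_proj G)
    \<and> \<not> (\<exists>S. induced_subgraph S (with_proj G) \<and>
           (complete_bipartite_digraph r (r + 1) S \<or> complete_bipartite_digraph (r + 1) (r + 1) S))
    \<and> max_degree (with_proj G) \<ge> 3 * r + 1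
    \<and> (real (max_degree (with_proj G)) + 2) / (real r + 1) \<ge> 3
    \<and> int (list_dist_chromatic_number (with_proj G)) \<le> 2 * int (max_degree (with_proj G)) - 5"
proof -
  interpret X: pair_graph X by fact
  interpret H: pair_graph H by fact
  have "pair_graph G"
    using assms pair_graph_graph_join by blast
  interpret G: pair_graph G by fact
  have card_X: "card (pverts X) = n - 2 * r + 1" and card_H: "card (pverts H) = 2 * r - 1"
    using assms by simp_all
  then have nonempty: "pverts X \<noteq> {}" "pverts H \<noteq> {}"
    using \<open>r > 6\<close> by auto
  have card_G: "card (pverts G) = n"
    using assms card_X card_H by (simp add: card_Plus)

  have conn: "k_connected (n - 2 * r + 1) (with_proj G)"
    unfolding \<open>G = graph_join X H\<close>
  proof (rule k_connected_graph_join)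
    have "k_connected (connectivity (with_proj X)) (with_proj X)"
      using nonempty by (intro k_connected_connectivity) auto
    then show "k_connected (n - 2 * r + 1 - card (pverts H)) (with_proj X)"
      by (rule k_connected_mono) (use assms in linarith)
    have "k_connected (connectivity (with_proj H)) (with_proj H)"
      using nonempty by (intro k_connected_connectivity) auto
    then show "k_connected (n - 2 * r + 1 - card (pverts X)) (with_proj H)"
      by (rule k_connected_mono) (simp add: card_X)
  qed simp_all

  have no_K: "\<not> complete_bipartite_digraph m (r + 1) S" if S: "induced_subgraph S (with_proj G)" for m S
  proof
    assume "complete_bipartite_digraph m (r + 1) S"
    with S obtain V where "independent_set (with_proj G) V" "card V = r + 1"
      by (rule induced_complete_bipartite_independent_set)
    then have "r + 1 \<le> max (independence_number (with_proj X)) (independence_number (with_proj H))"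
      using card_independent_set_graph_join[of X H V] assms by simp
    then show False using assms by linarith
  qed

  have deg: "3 * r + 1 \<le> max_degree (with_proj G)"
    using max_degree_graph_join_ge[of X H] assms nonempty by simp
  have deg_H: "n - 2 * r + 1 \<le> max_degree (with_proj G)"
    using card_left_le_max_degree_graph_join[of X H] assms nonempty card_X by simp
  have ratio: "3 \<le> (real (max_degree (with_proj G)) + 2) / (real r + 1)"
  proof -
    have "3 * real r + 1 \<le> real (max_degree (with_proj G))"
      using deg by (simp flip: of_nat_le_iff)
    then show ?thesis by (simp add: field_simps)
  qed

  have "digraph (with_proj G)" by unfold_locales
  then have "list_dist_chromatic_number (with_proj G) \<le> n"
    using list_dist_chromatic_number_le_card[of "with_proj G"] card_G by simp
  moreover have "int n \<le> 2 * int (max_degree (with_proj G)) - 5"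
    using deg deg_H assms by linarith
  ultimately have "int (list_dist_chromatic_number (with_proj G))
      \<le> 2 * int (max_degree (with_proj G)) - 5"
    by linarith
  with conn no_K deg ratio show ?thesis by blast
qed

end
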